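(* For a Hausdorff space $X$, $$|X|\leq 2^{saL_c(X,2^{t(X)\psi_c(X)})\,t(X)\,\psi_c(X)}.$$
   Context: $t(X)$ is the tightness of $X$. The closed pseudo-character $\psi_c(X)$ is the least infinite cardinal $\kappa$ such that every $x\in X$ has a family $\mathcal{B}$ of at most $\kappa$ open neighborhoods with $\{x\}=\bigcap\{\mathrm{cl}\,B:B\in\mathcal{B}\}$. Cardinal functions are taken to be infinite. For $A\subseteq X$ and an infinite cardinal $\lambda$, $saL(A,X,\lambda)$ is the least infinite cardinal $\kappa$ such that for every cover $\mathcal{U}$ of $A$ by open sets of $X$ there exists $\mathcal{V}\subseteq\mathcal{U}$ with $|\mathcal{V}|\leq\kappa$ and $|A\setminus\bigcup_{V\in\mathcal{V}}\mathrm{cl}\,V|<\lambda$. The skew-$\lambda$ almost Lindelöf degree with respect to closed sets is $saL_c(X,\lambda)=\sup\{saL(A,X,\lambda):A\text{ is a closed subset of }X\}$. *)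

theory Defs
  imports "HOL-Analysis.T1_Spaces"
begin

unbundle cardinal_syntax

text \<open>
  Cardinals are the cardinal orders (\<open>Card_order\<close>) of the library, compared with \<open>\<le>o\<close> and \<open><o\<close>.
  A cardinal function of a space on a set of points of type \<open>'a\<close> is a cardinal order on a subset of
  \<open>'a + nat\<close>: this type carries a copy of every cardinal that is at most \<open>|X| + \<omega>\<close>, and all
  the cardinal functions below are at most \<open>|X| + \<omega>\<close> (see the lemmas; for the closed
  pseudo-character this needs the space to be Hausdorff). The least cardinal is
  determined up to order isomorphism, i.e. up to \<open>=o\<close>.
\<close>

definition least_infinite_card :: "('b rel \<Rightarrow> bool) \<Rightarrow> 'b rel" where
  "least_infinite_card P =
    (SOME r. Card_order r \<and> cinfinite r \<and> P r \<and>
       (\<forall>r'. Card_order r' \<and> cinfinite r' \<and> P r' \<longrightarrow> r \<le>o r'))"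

definition tightness_le :: "'a topology \<Rightarrow> 'b rel \<Rightarrow> bool" where
  "tightness_le X \<kappa> \<longleftrightarrow>
    (\<forall>A x. A \<subseteq> topspace X \<and> x \<in> X closure_of A \<longrightarrow>
       (\<exists>B. B \<subseteq> A \<and> |B| \<le>o \<kappa> \<and> x \<in> X closure_of B))"

definition tightness :: "'a topology \<Rightarrow> ('a + nat) rel" where
  "tightness X = least_infinite_card (tightness_le X)"

definition closed_pseudo_character_le :: "'a topology \<Rightarrow> 'b rel \<Rightarrow> bool" where
  "closed_pseudo_character_le X \<kappa> \<longleftrightarrow>
    (\<forall>x \<in> topspace X. \<exists>\<B>. (\<forall>B \<in> \<B>. openin X B \<and> x \<in> B) \<and> |\<B>| \<le>o \<kappa> \<and>
       {x} = (\<Inter>B \<in> \<B>. X closure_of B))"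

definition closed_pseudo_character :: "'a topology \<Rightarrow> ('a + nat) rel" where
  "closed_pseudo_character X = least_infinite_card (closed_pseudo_character_le X)"

definition saL_le :: "'a set \<Rightarrow> 'a topology \<Rightarrow> 'c rel \<Rightarrow> 'b rel \<Rightarrow> bool" where
  "saL_le A X \<mu> \<kappa> \<longleftrightarrow>
    (\<forall>\<U>. (\<forall>U \<in> \<U>. openin X U) \<and> A \<subseteq> \<Union>\<U> \<longrightarrow>
       (\<exists>\<V>. \<V> \<subseteq> \<U> \<and> |\<V>| \<le>o \<kappa> \<and> |A - (\<Union>V \<in> \<V>. X closure_of V)| <o \<mu>))"

definition saL :: "'a set \<Rightarrow> 'a topology \<Rightarrow> 'c rel \<Rightarrow> ('a + nat) rel" where
  "saL A X \<mu> = least_infinite_card (saL_le A X \<mu>)"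

text \<open>The supremum of a set of infinite cardinals is their least infinite upper bound.\<close>

definition saL_c :: "'a topology \<Rightarrow> 'c rel \<Rightarrow> ('a + nat) rel" where
  "saL_c X \<mu> = least_infinite_card (\<lambda>\<kappa>. \<forall>A. closedin X A \<longrightarrow> saL A X \<mu> \<le>o \<kappa>)"

lemma least_infinite_card:
  assumes "Card_order r0" "cinfinite r0" "P r0"
  shows "Card_order (least_infinite_card P)" "cinfinite (least_infinite_card P)"
    "P (least_infinite_card P)"
    "\<And>r. Card_order r \<Longrightarrow> cinfinite r \<Longrightarrow> P r \<Longrightarrow> least_infinite_card P \<le>o r"
proof -
  let ?R = "{r. Card_order r \<and> cinfinite r \<and> P r}"
  have "\<exists>r \<in> ?R. \<forall>r' \<in> ?R. r \<le>o r'"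
    using assms by (intro exists_minim_Card_order) auto
  then have ex: "\<exists>r. Card_order r \<and> cinfinite r \<and> P r \<and>
       (\<forall>r'. Card_order r' \<and> cinfinite r' \<and> P r' \<longrightarrow> r \<le>o r')"
    by blast
  note * = someI_ex[OF ex, folded least_infinite_card_def]
  show "Card_order (least_infinite_card P)" "cinfinite (least_infinite_card P)"
    "P (least_infinite_card P)"
    "\<And>r. Card_order r \<Longrightarrow> cinfinite r \<Longrightarrow> P r \<Longrightarrow> least_infinite_card P \<le>o r"
    using * by blast+
qed

lemma cinfinite_card_of_sum_nat: "cinfinite |UNIV :: ('a + nat) set|"
  by (simp add: cinfinite_def Field_card_of finite_Plus_UNIV_iff)

lemma card_of_image_le_sum_nat:
  fixes A :: "'a set"
  shows "|f ` A| \<le>o |UNIV :: ('a + nat) set|"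
proof -
  have "|A| \<le>o |UNIV :: ('a + nat) set|"
    by (rule card_of_ordLeqI[of Inl]) auto
  then show ?thesis
    using card_of_image ordLeq_transitive by blast
qed

lemma card_of_le_sum_nat: "|A :: 'a set| \<le>o |UNIV :: ('a + nat) set|"
  using card_of_image_le_sum_nat[of "\<lambda>x. x" A] by simp

lemma tightness_le_UNIV: "tightness_le (X :: 'a topology) |UNIV :: ('a + nat) set|"
  unfolding tightness_le_def using card_of_le_sum_nat by blast

lemma closed_pseudo_character_le_UNIV:
  assumes "Hausdorff_space (X :: 'a topology)"
  shows "closed_pseudo_character_le X |UNIV :: ('a + nat) set|"
  unfolding closed_pseudo_character_le_def
proof
  fix x assume x: "x \<in> topspace X"
  have "\<exists>B. openin X B \<and> x \<in> B \<and> (y \<in> topspace X \<and> y \<noteq> x \<longrightarrow> y \<notin> X closure_of B)" for y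
  proof (cases "y \<in> topspace X \<and> y \<noteq> x")
    case True
    with assms x have "\<exists>U V. openin X U \<and> openin X V \<and> x \<in> U \<and> y \<in> V \<and> disjnt U V"
      unfolding Hausdorff_space_def by metis
    then obtain U V where UV: "openin X U" "openin X V" "x \<in> U" "y \<in> V" "disjnt U V"
      by (elim exE conjE)
    then have "y \<notin> X closure_of U"
      unfolding in_closure_of disjnt_def by blast
    with UV show ?thesis by blast
  next
    case False
    then show ?thesis using x openin_topspace by blast
  qed
  then have "\<forall>y. \<exists>B. openin X B \<and> x \<in> B \<and> (y \<in> topspace X \<and> y \<noteq> x \<longrightarrow> y \<notin> X closure_of B)"
    by (rule allI)
  from choice[OF this] obtain B where
    B: "\<forall>y. openin X (B y) \<and> x \<in> B y \<and> (y \<in> topspace X \<and> y \<noteq> x \<longrightarrow> y \<notin> X closure_of B y)"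
    by (elim exE)
  have 1: "x \<in> X closure_of B y" for y
    using B closure_of_subset[OF openin_subset] by (meson subsetD)
  have 2: "y = x" if y: "\<forall>z. y \<in> X closure_of B z" for y
  proof -
    have "y \<in> topspace X" using y by (meson in_closure_of)
    then show ?thesis using y B by (meson)
  qed
  have "{x} = (\<Inter>C \<in> range B. X closure_of C)"
  proof (rule set_eqI)
    fix y
    show "y \<in> {x} \<longleftrightarrow> y \<in> (\<Inter>C \<in> range B. X closure_of C)"
      unfolding INT_iff ball_simps singleton_iff using 1 2 by auto
  qed
  moreover have "\<forall>C \<in> range B. openin X C \<and> x \<in> C" using B by blast
  moreover have "|range B| \<le>o |UNIV :: ('a + nat) set|" by (rule card_of_image_le_sum_nat)
  ultimately show "\<exists>\<B>. (\<forall>B \<in> \<B>. openin X B \<and> x \<in> B) \<and> |\<B>| \<le>o |UNIV :: ('a + nat) set| \<and>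
       {x} = (\<Inter>B \<in> \<B>. X closure_of B)"
    by blast
qed

lemma saL_le_UNIV:
  assumes "Card_order \<mu>" "cinfinite \<mu>"
  shows "saL_le A (X :: 'a topology) \<mu> |UNIV :: ('a + nat) set|"
  unfolding saL_le_def
proof (intro allI impI, elim conjE)
  fix \<U> assume U: "\<forall>U \<in> \<U>. openin X U" "A \<subseteq> \<Union>\<U>"
  then have "\<forall>a \<in> A. \<exists>V. V \<in> \<U> \<and> a \<in> V" by blast
  from bchoice[OF this] obtain f where f: "\<forall>a \<in> A. f a \<in> \<U> \<and> a \<in> f a" by (elim exE)
  have "a \<in> X closure_of f a" if "a \<in> A" for a
    using f U(1) that closure_of_subset[OF openin_subset] by (meson subsetD)
  then have e: "A - (\<Union>V \<in> f ` A. X closure_of V) = {}" by blast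
  have "|{} :: 'a set| <o \<mu>"
    by (rule finite_ordLess_infinite[OF card_of_Well_order])
      (use assms in \<open>simp_all add: cinfinite_def Field_card_of card_order_on_def\<close>)
  then have "|A - (\<Union>V \<in> f ` A. X closure_of V)| <o \<mu>" unfolding e .
  moreover have "f ` A \<subseteq> \<U>" using f by blast
  moreover have "|f ` A| \<le>o |UNIV :: ('a + nat) set|" by (rule card_of_image_le_sum_nat)
  ultimately show "\<exists>\<V>. \<V> \<subseteq> \<U> \<and> |\<V>| \<le>o |UNIV :: ('a + nat) set| \<and>
      |A - (\<Union>V \<in> \<V>. X closure_of V)| <o \<mu>"
    by blast
qed

lemma saL_le_card_UNIV:
  assumes "Card_order \<mu>" "cinfinite \<mu>"
  shows "saL A (X :: 'a topology) \<mu> \<le>o |UNIV :: ('a + nat) set|"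
  unfolding saL_def
  by (intro least_infinite_card(4)[where ?r0.0 = "|UNIV :: ('a + nat) set|"]
      card_of_Card_order cinfinite_card_of_sum_nat saL_le_UNIV[OF assms])

lemma tightness:
  "Card_order (tightness X)" "cinfinite (tightness X)" "tightness_le X (tightness X)"
  unfolding tightness_def
  by (rule least_infinite_card(1-3)[where P = "tightness_le X" and ?r0.0 = "|UNIV|"],
      rule card_of_Card_order, rule cinfinite_card_of_sum_nat, rule tightness_le_UNIV)+

lemma closed_pseudo_character:
  assumes "Hausdorff_space X"
  shows "Card_order (closed_pseudo_character X)" "cinfinite (closed_pseudo_character X)"
    "closed_pseudo_character_le X (closed_pseudo_character X)"
  unfolding closed_pseudo_character_def
  by (rule least_infinite_card(1-3)[where P = "closed_pseudo_character_le X" and ?r0.0 = "|UNIV|"],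
      rule card_of_Card_order, rule cinfinite_card_of_sum_nat,
      rule closed_pseudo_character_le_UNIV[OF assms])+

lemma saL:
  assumes "Card_order \<mu>" "cinfinite \<mu>"
  shows "Card_order (saL A X \<mu>)" "cinfinite (saL A X \<mu>)" "saL_le A X \<mu> (saL A X \<mu>)"
  unfolding saL_def
  by (rule least_infinite_card(1-3)[where P = "saL_le A X \<mu>" and ?r0.0 = "|UNIV|"],
      rule card_of_Card_order, rule cinfinite_card_of_sum_nat, rule saL_le_UNIV[OF assms])+

lemma saL_c:
  assumes "Card_order \<mu>" "cinfinite \<mu>"
  shows "Card_order (saL_c X \<mu>)" "cinfinite (saL_c X \<mu>)"
    "\<forall>A. closedin X A \<longrightarrow> saL A X \<mu> \<le>o saL_c X \<mu>"
  unfolding saL_c_def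
  by (rule least_infinite_card(1-3)[where P = "\<lambda>\<kappa>. \<forall>A. closedin X A \<longrightarrow> saL A X \<mu> \<le>o \<kappa>"
        and ?r0.0 = "|UNIV|"],
      rule card_of_Card_order, rule cinfinite_card_of_sum_nat,
      intro allI impI saL_le_card_UNIV[OF assms])+

end

theory Submission
  imports Defs
begin

text \<open>
  Let \<open>\<kappa>\<close> be the exponent on the right-hand side, so that \<open>\<kappa>\<close> bounds the tightness, the closed
  pseudo-character and the skew almost Lindelof degrees of all closed sets. The argument is a
  closing-off: a set \<open>H\<close> of at most \<open>2\<^sup>\<kappa>\<close> points is closed under enough operations on its subsets
  of size at most \<open>\<kappa>\<close> that no point can be outside it (\<open>card_of_topspace_le\<close>).

  Fix for every point a family of at most \<open>\<kappa>\<close> open neighbourhoods whose closures meet in that point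
  only. First, \<open>H\<close> contains the closure of each of its small subsets; by tightness \<open>H\<close> is then a
  closed set. Second, for each small family \<open>\<V>\<close> of the fixed neighbourhoods of points of \<open>H\<close>, let
  \<open>out \<V>\<close> be the set of points not covered by the closures of the members of \<open>\<V>\<close>; then \<open>H\<close> contains
  all of \<open>out \<V>\<close>, or at least \<open>2\<^sup>\<kappa>\<close> of its points. Suppose \<open>p \<notin> H\<close>. The fixed neighbourhoods of
  points of \<open>H\<close> whose closures miss \<open>p\<close> cover \<open>H\<close>, so a small family \<open>\<V>\<close> of them leaves fewer than
  \<open>2\<^sup>\<kappa>\<close> points of \<open>H\<close> uncovered by closures. Hence \<open>H\<close> contains all of \<open>out \<V>\<close>, and in particular
  \<open>p\<close>, a contradiction. This is why a skew degree suffices: what matters about the uncovered part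
  of \<open>H\<close> is only that it has fewer than \<open>2\<^sup>\<kappa>\<close> points, not that it is empty.

  That \<open>H\<close> needs at most \<open>2\<^sup>\<kappa>\<close> points rests on three facts: a set of size \<open>2\<^sup>\<kappa>\<close> has only \<open>2\<^sup>\<kappa>\<close> subsets of
  size at most \<open>\<kappa>\<close> (\<open>card_of_small_subsets_le\<close>), a closing-off stops after \<open>\<kappa>\<^sup>+ \<le> 2\<^sup>\<kappa>\<close> stages
  (\<open>closing_off\<close>), and the closure of a set of size at most \<open>2\<^sup>\<kappa>\<close> has size at most \<open>2\<^sup>\<kappa>\<close>
  (\<open>card_of_closure_le\<close>). Throughout, a set is called small if its size is at most \<open>\<kappa>\<close>.
\<close>

section \<open>Cardinal arithmetic below a power of two\<close>

lemma Cinfinite_ctwo_cexp: "Cinfinite \<kappa> \<Longrightarrow> Cinfinite (ctwo ^c \<kappa>)"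
  using Card_order_ctwo by (intro Cinfinite_cexp) (auto simp: ordLeq_refl)

lemma ordLeq_ctwo_cexp: "Card_order \<kappa> \<Longrightarrow> \<kappa> \<le>o ctwo ^c \<kappa>"
  by (rule ordLess_imp_ordLeq[OF ordLess_ctwo_cexp])

text \<open>The point of measuring sizes by \<open>2\<^sup>\<kappa>\<close>: since \<open>(2\<^sup>\<kappa>)\<^sup>\<kappa> = 2\<^sup>\<kappa>\<close>, passing to the small subsets
  does not lead to a larger cardinal.\<close>

lemma card_of_small_subsets_le:
  fixes A :: "'a set"
  assumes \<kappa>: "Cinfinite \<kappa>" and A: "|A| \<le>o ctwo ^c \<kappa>"
  shows "|{S. S \<subseteq> A \<and> |S| \<le>o \<kappa>}| \<le>o ctwo ^c \<kappa>"
proof -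
  let ?N = "ctwo ^c \<kappa>"
  have N: "Cinfinite ?N" using \<kappa> by (rule Cinfinite_ctwo_cexp)
  have "|A| ^c \<kappa> \<le>o ?N ^c \<kappa>" using A \<kappa> by (intro cexp_mono1) auto
  also have "?N ^c \<kappa> =o ?N"
    using \<kappa> by (intro cexp_cprod_ordLeq Card_order_ctwo Cinfinite_Cnotzero) (auto simp: ordLeq_refl)
  finally have "|Func (Field \<kappa>) A| \<le>o ?N" unfolding cexp_def Field_card_of .
  then have 1: "|(\<lambda>f. f ` Field \<kappa>) ` Func (Field \<kappa>) A| \<le>o ?N"
    by (rule ordLeq_transitive[OF card_of_image])
  have 2: "|{{}} :: 'a set set| \<le>o ?N"
    using N unfolding cinfinite_def by (intro Card_order_singl_ordLeq) auto
  have "{S. S \<subseteq> A \<and> |S| \<le>o \<kappa>} \<subseteq> (\<lambda>f. f ` Field \<kappa>) ` Func (Field \<kappa>) A \<union> {{}}"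
  proof
    fix S assume "S \<in> {S. S \<subseteq> A \<and> |S| \<le>o \<kappa>}"
    then have S: "S \<subseteq> A" "|S| \<le>o \<kappa>" by auto
    show "S \<in> (\<lambda>f. f ` Field \<kappa>) ` Func (Field \<kappa>) A \<union> {{}}"
    proof (cases "S = {}")
      case False
      \<comment> \<open>A nonempty small set is the range of a function on the field of \<open>\<kappa>\<close>.\<close>
      have "|S| \<le>o |Field \<kappa>|"
        using \<kappa> by (intro ordLeq_ordIso_trans[OF S(2) ordIso_symmetric[OF card_of_Field_ordIso]]) auto
      from iffD2[OF card_of_ordLeq2[OF False] this]
      obtain g where g: "g ` Field \<kappa> = S" by (elim exE)
      let ?f = "\<lambda>a. if a \<in> Field \<kappa> then g a else undefined"
      have "?f \<in> Func (Field \<kappa>) A" using g S(1) by (auto simp: Func_def)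
      moreover have "?f ` Field \<kappa> = S" using g by auto
      ultimately show ?thesis by blast
    qed simp
  qed
  then show ?thesis
    using N unfolding cinfinite_def
    by (intro ordLeq_transitive[OF card_of_mono1 card_of_Un_ordLeq_infinite_Field[OF _ 1 2]]) auto
qed

section \<open>Closing off under an operation on small sets\<close>

text \<open>The stages of the closing-off, indexed by a well-order \<open>r\<close>. An inductive predicate replaces
  transfinite recursion: stage \<open>i\<close> is the union of the sets \<open>F S\<close> over the small sets \<open>S\<close> of points
  of earlier stages.\<close>

inductive closing_stage :: "('a set \<Rightarrow> 'a set) \<Rightarrow> 'b rel \<Rightarrow> 'c rel \<Rightarrow> 'c \<Rightarrow> 'a \<Rightarrow> bool"
  for F \<kappa> r where
  "(\<And>s. s \<in> S \<Longrightarrow> \<exists>j. (j, i) \<in> r \<and> j \<noteq> i \<and> closing_stage F \<kappa> r j s) \<Longrightarrow> |S| \<le>o \<kappa> \<Longrightarrow> x \<in> F S \<Longrightarrow>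
   closing_stage F \<kappa> r i x"

text \<open>Each stage has at most \<open>2\<^sup>\<kappa>\<close> points, by induction along the index, as only \<open>2\<^sup>\<kappa>\<close> small sets
  are available. There are \<open>\<kappa>\<^sup>+ \<le> 2\<^sup>\<kappa>\<close> stages, and since \<open>\<kappa>\<^sup>+\<close> is regular, every small subset of
  their union already lies in a single stage.\<close>

lemma closing_off:
  fixes F :: "'a set \<Rightarrow> 'a set" and \<kappa> :: "'b rel"
  assumes \<kappa>: "Cinfinite \<kappa>"
    and FT: "\<And>S. S \<subseteq> T \<Longrightarrow> |S| \<le>o \<kappa> \<Longrightarrow> F S \<subseteq> T"
    and F: "\<And>S. S \<subseteq> T \<Longrightarrow> |S| \<le>o \<kappa> \<Longrightarrow> |F S| \<le>o ctwo ^c \<kappa>"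
  obtains H where "H \<subseteq> T" "|H| \<le>o ctwo ^c \<kappa>" "\<And>S. S \<subseteq> H \<Longrightarrow> |S| \<le>o \<kappa> \<Longrightarrow> F S \<subseteq> H"
proof -
  let ?r = "cardSuc \<kappa>" and ?N = "ctwo ^c \<kappa>"
  let ?P = "closing_stage F \<kappa> ?r"
  define As where "As i = {x. ?P i x}" for i
  have N: "Cinfinite ?N" using \<kappa> by (rule Cinfinite_ctwo_cexp)
  have Ninf: "\<not> finite (Field ?N)" using N unfolding cinfinite_def by simp
  have r: "Cinfinite ?r" using \<kappa> by (rule Cinfinite_cardSuc)
  have wo: "Well_order ?r" using r by (simp add: card_order_on_def)
  have "trans ?r" "antisym ?r" "wf (?r - Id)"
    using wo unfolding well_order_on_def linear_order_on_def partial_order_on_def preorder_on_def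
    by auto
  have rN: "?r \<le>o ?N"
    using \<kappa> N by (intro cardSuc_least ordLess_ctwo_cexp) auto
  have FrN: "|Field ?r| \<le>o ?N"
    using r by (intro ordIso_ordLeq_trans[OF card_of_Field_ordIso rN]) auto
  have AsT: "As i \<subseteq> T" for i
  proof
    fix x assume "x \<in> As i"
    then have "?P i x" by (simp add: As_def)
    then show "x \<in> T"
    proof induction
      case (1 S i x)
      then have "S \<subseteq> T" by blast
      with 1 FT show ?case by blast
    qed
  qed
  have step: "F S \<subseteq> As i" if "S \<subseteq> (\<Union>j \<in> underS ?r i. As j)" "|S| \<le>o \<kappa>" for S i
  proof
    fix x assume "x \<in> F S"
    with that show "x \<in> As i" unfolding As_def underS_def
      by (intro CollectI closing_stage.intros[of S]) auto
  qed
  have As_eq: "As i \<subseteq> (\<Union>S \<in> {S. S \<subseteq> (\<Union>j \<in> underS ?r i. As j) \<and> |S| \<le>o \<kappa>}. F S)" for i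
  proof
    fix x assume "x \<in> As i"
    then have "?P i x" by (simp add: As_def)
    then show "x \<in> (\<Union>S \<in> {S. S \<subseteq> (\<Union>j \<in> underS ?r i. As j) \<and> |S| \<le>o \<kappa>}. F S)"
    proof cases
      case (1 S)
      then have "S \<subseteq> (\<Union>j \<in> underS ?r i. As j)"
        unfolding As_def underS_def by blast
      with 1(2,3) show ?thesis by blast
    qed
  qed
  have As_card: "|As i| \<le>o ?N" for i
    using \<open>wf (?r - Id)\<close>
  proof (induction i rule: wf_induct_rule)
    case (less i)
    let ?U = "\<Union>j \<in> underS ?r i. As j"
    have "underS ?r i \<subseteq> Field ?r" unfolding underS_def Field_def by auto
    then have "|underS ?r i| \<le>o ?N"
      by (rule ordLeq_transitive[OF card_of_mono1 FrN])
    moreover have "\<forall>j \<in> underS ?r i. |As j| \<le>o ?N" using less unfolding underS_def by auto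
    ultimately have "|?U| \<le>o ?N"
      using N by (intro card_of_UNION_ordLeq_infinite_Field[OF Ninf]) auto
    then have "|{S. S \<subseteq> ?U \<and> |S| \<le>o \<kappa>}| \<le>o ?N" by (rule card_of_small_subsets_le[OF \<kappa>])
    moreover have "\<forall>S \<in> {S. S \<subseteq> ?U \<and> |S| \<le>o \<kappa>}. |F S| \<le>o ?N"
    proof
      fix S assume S: "S \<in> {S. S \<subseteq> ?U \<and> |S| \<le>o \<kappa>}"
      then have "S \<subseteq> T" using AsT by blast
      with S F show "|F S| \<le>o ?N" by simp
    qed
    ultimately have "|\<Union>S \<in> {S. S \<subseteq> ?U \<and> |S| \<le>o \<kappa>}. F S| \<le>o ?N"
      using N by (intro card_of_UNION_ordLeq_infinite_Field[OF Ninf]) auto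
    then show ?case by (rule ordLeq_transitive[OF card_of_mono1[OF As_eq]])
  qed
  have chain: "relChain ?r As"
    unfolding relChain_def
  proof (intro allI impI)
    fix i j assume ij: "(i, j) \<in> ?r"
    have "underS ?r i \<subseteq> underS ?r j"
      using ij \<open>trans ?r\<close> \<open>antisym ?r\<close> unfolding underS_def
      by (auto dest: transD antisymD)
    then have "F S \<subseteq> As j" if "S \<subseteq> (\<Union>k \<in> underS ?r i. As k)" "|S| \<le>o \<kappa>" for S
      using that by (intro step) blast+
    then show "As i \<subseteq> As j" using As_eq[of i] by blast
  qed
  define H where "H = (\<Union>i \<in> Field ?r. As i)"
  show ?thesis
  proof
    show "H \<subseteq> T" using AsT unfolding H_def by blast
    show "|H| \<le>o ?N"
      unfolding H_def using N As_card
      by (intro card_of_UNION_ordLeq_infinite_Field[OF Ninf _ FrN]) auto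
    fix S assume S: "S \<subseteq> H" "|S| \<le>o \<kappa>"
    obtain i where i: "i \<in> Field ?r" "S \<subseteq> As i"
      using cardSuc_UNION_Cinfinite[OF \<kappa> chain _ S(2)] S(1) unfolding H_def by blast
    \<comment> \<open>An infinite cardinal has no last element, so the stage that contains \<open>S\<close> has a later one.\<close>
    obtain j where j: "j \<in> Field ?r" "i \<noteq> j" "(i, j) \<in> ?r"
      using Cinfinite_limit[OF i(1) r] by blast
    then have "S \<subseteq> (\<Union>k \<in> underS ?r j. As k)" using i(2) unfolding underS_def by blast
    then have "F S \<subseteq> As j" using S(2) by (rule step)
    then show "F S \<subseteq> H" using j(1) unfolding H_def by blast
  qed
qed

section \<open>The cardinality of closures\<close>

text \<open>A point \<open>x\<close> of the closure of \<open>A\<close> is determined by few small subsets of \<open>A\<close>: it lies in the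
  closure of \<open>A \<inter> B\<close> for each neighbourhood \<open>B\<close> of a closed pseudo-base at \<open>x\<close>, hence in the closure
  of a small \<open>S\<^sub>B \<subseteq> A \<inter> B\<close>; the closures of the \<open>S\<^sub>B\<close> meet in \<open>x\<close> only.\<close>

lemma card_of_closure_le:
  assumes \<kappa>: "Cinfinite \<kappa>" and t: "tightness_le X \<kappa>" and \<psi>: "closed_pseudo_character_le X \<kappa>"
    and A: "A \<subseteq> topspace X" "|A| \<le>o ctwo ^c \<kappa>"
  shows "|X closure_of A| \<le>o ctwo ^c \<kappa>"
proof -
  let ?T = "{S. S \<subseteq> A \<and> |S| \<le>o \<kappa>}"
  let ?Q = "{\<S>. \<S> \<subseteq> ?T \<and> |\<S>| \<le>o \<kappa>}"
  let ?g = "\<lambda>\<S>. THE x. {x} = (\<Inter>S \<in> \<S>. X closure_of S)"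
  have "|?Q| \<le>o ctwo ^c \<kappa>"
    by (intro card_of_small_subsets_le \<kappa> A(2))
  then have "|?g ` ?Q| \<le>o ctwo ^c \<kappa>" by (rule ordLeq_transitive[OF card_of_image])
  moreover have "X closure_of A \<subseteq> ?g ` ?Q"
  proof
    fix x assume x: "x \<in> X closure_of A"
    then have "x \<in> topspace X" by (simp add: in_closure_of)
    from bspec[OF \<psi>[unfolded closed_pseudo_character_le_def] this]
    obtain \<B> where \<B>: "\<And>B. B \<in> \<B> \<Longrightarrow> openin X B \<and> x \<in> B" "|\<B>| \<le>o \<kappa>"
      "{x} = (\<Inter>B \<in> \<B>. X closure_of B)"
      by (elim exE conjE) auto
    have "\<exists>S. S \<subseteq> A \<inter> B \<and> |S| \<le>o \<kappa> \<and> x \<in> X closure_of S" if "B \<in> \<B>" for B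
    proof -
      have "x \<in> X closure_of (A \<inter> B)"
        using x \<B>(1)[OF that] unfolding in_closure_of
        by (metis Int_iff openin_Int)
      moreover have "A \<inter> B \<subseteq> topspace X" using A(1) by blast
      ultimately show ?thesis using t unfolding tightness_le_def by meson
    qed
    then obtain f where f: "\<And>B. B \<in> \<B> \<Longrightarrow> f B \<subseteq> A \<inter> B \<and> |f B| \<le>o \<kappa> \<and> x \<in> X closure_of f B"
      by metis
    have "{x} = (\<Inter>S \<in> f ` \<B>. X closure_of S)"
    proof
      show "{x} \<subseteq> (\<Inter>S \<in> f ` \<B>. X closure_of S)" using f by blast
      have "X closure_of f B \<subseteq> X closure_of B" if "B \<in> \<B>" for B
        using f[OF that] by (intro closure_of_mono) blast
      then show "(\<Inter>S \<in> f ` \<B>. X closure_of S) \<subseteq> {x}" unfolding \<B>(3) by blast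
    qed
    then have "x = ?g (f ` \<B>)" by (metis (mono_tags, lifting) singleton_inject the_equality)
    moreover have "f ` \<B> \<in> ?Q"
      using f ordLeq_transitive[OF card_of_image[of f \<B>] \<B>(2)] by auto
    ultimately show "x \<in> ?g ` ?Q" by (rule image_eqI)
  qed
  ultimately show ?thesis
    by (rule ordLeq_transitive[OF card_of_mono1, rotated])
qed

section \<open>The bound on the number of points\<close>

text \<open>Applied with \<open>\<nu> = 2\<^sup>\<kappa>\<close> to the uncovered part \<open>Y\<close> of a space, this gives the points that the
  closing-off adds: few enough to keep it bounded, but enough that a closed-off set with fewer than
  \<open>\<nu>\<close> points in \<open>Y\<close> must contain \<open>Y\<close>.\<close>

lemma truncated_subset:
  assumes "Card_order \<nu>"
  obtains C where "C \<subseteq> Y" "|C| \<le>o \<nu>" "C = Y \<or> \<nu> \<le>o |C|"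
proof (cases "|Y| \<le>o \<nu>")
  case True
  then show ?thesis using that by blast
next
  case False
  then have "\<nu> \<le>o |Y|"
    using assms card_of_Well_order by (metis card_order_on_def ordLeq_total)
  then have "|Field \<nu>| \<le>o |Y|"
    by (rule ordIso_ordLeq_trans[OF card_of_Field_ordIso[OF assms]])
  from iffD1[OF internalize_card_of_ordLeq2 this]
  obtain C where C: "C \<subseteq> Y" "|Field \<nu>| =o |C|"
    by (elim exE conjE)
  have "\<nu> =o |C|"
    by (rule ordIso_transitive[OF ordIso_symmetric[OF card_of_Field_ordIso[OF assms]] C(2)])
  then show ?thesis
    using that[OF C(1)] ordIso_imp_ordLeq ordIso_symmetric by metis
qed

text \<open>The closing-off itself, for any common bound \<open>\<kappa>\<close> of the cardinal functions involved. The skew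
  parameter \<open>\<mu>\<close> enters only through \<open>\<mu> \<le> 2\<^sup>\<kappa>\<close>: the contradiction is that \<open>H\<close> would have at least
  \<open>2\<^sup>\<kappa>\<close> points in a set that meets it in fewer than \<open>\<mu>\<close>.\<close>

lemma card_of_topspace_le:
  fixes X :: "'a topology" and \<kappa> :: "'b rel"
  assumes \<kappa>: "Cinfinite \<kappa>" and t: "tightness_le X \<kappa>" and \<psi>: "closed_pseudo_character_le X \<kappa>"
    and L: "\<And>A. closedin X A \<Longrightarrow> saL_le A X \<mu> \<kappa>" and \<mu>: "\<mu> \<le>o ctwo ^c \<kappa>"
  shows "|topspace X| \<le>o ctwo ^c \<kappa>"
proof -
  let ?N = "ctwo ^c \<kappa>"
  have N: "Cinfinite ?N" using \<kappa> by (rule Cinfinite_ctwo_cexp)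
  have Ninf: "\<not> finite (Field ?N)" using N unfolding cinfinite_def by simp
  have \<kappa>inf: "\<not> finite (Field \<kappa>)" using \<kappa> unfolding cinfinite_def by simp
  have \<kappa>N: "\<kappa> \<le>o ?N" using \<kappa> by (intro ordLeq_ctwo_cexp) auto
  obtain \<B> where \<B>: "\<And>x. x \<in> topspace X \<Longrightarrow> (\<forall>B \<in> \<B> x. openin X B \<and> x \<in> B) \<and>
      |\<B> x| \<le>o \<kappa> \<and> {x} = (\<Inter>B \<in> \<B> x. X closure_of B)"
    using \<psi> unfolding closed_pseudo_character_le_def by metis
  let ?out = "\<lambda>\<V>. topspace X - (\<Union>V \<in> \<V>. X closure_of V)"
  have "\<forall>\<V>. \<exists>C. C \<subseteq> ?out \<V> \<and> |C| \<le>o ?N \<and> (C = ?out \<V> \<or> ?N \<le>o |C| )"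
  proof
    fix \<V>
    obtain C where "C \<subseteq> ?out \<V>" "|C| \<le>o ?N" "C = ?out \<V> \<or> ?N \<le>o |C|"
      by (rule truncated_subset[OF conjunct2[OF N]])
    then show "\<exists>C. C \<subseteq> ?out \<V> \<and> |C| \<le>o ?N \<and> (C = ?out \<V> \<or> ?N \<le>o |C| )"
      by (intro exI conjI)
  qed
  from choice[OF this] obtain C where
    C: "\<forall>\<V>. C \<V> \<subseteq> ?out \<V> \<and> |C \<V>| \<le>o ?N \<and> (C \<V> = ?out \<V> \<or> ?N \<le>o |C \<V>| )"
    by (elim exE)
  have C_sub: "C \<V> \<subseteq> ?out \<V>" and C_card: "|C \<V>| \<le>o ?N"
    and C_big: "C \<V> = ?out \<V> \<or> ?N \<le>o |C \<V>|" for \<V>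
    using C by simp_all
  define Vs where "Vs S = {\<V>. \<V> \<subseteq> (\<Union>x \<in> S. \<B> x) \<and> |\<V>| \<le>o \<kappa>}" for S
  define F where "F S = X closure_of S \<union> (\<Union>\<V> \<in> Vs S. C \<V>)" for S
  have FT: "F S \<subseteq> topspace X" for S
    unfolding F_def
    by (intro Un_least UN_least closure_of_subset_topspace subset_trans[OF C_sub Diff_subset])
  have F_card: "|F S| \<le>o ?N" if S: "S \<subseteq> topspace X" "|S| \<le>o \<kappa>" for S
  proof -
    have "|S| \<le>o ?N" by (rule ordLeq_transitive[OF S(2) \<kappa>N])
    then have 1: "|X closure_of S| \<le>o ?N" by (rule card_of_closure_le[OF \<kappa> t \<psi> S(1)])
    have "\<forall>x \<in> S. |\<B> x| \<le>o \<kappa>" using \<B> S(1) by blast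
    then have "|\<Union>x \<in> S. \<B> x| \<le>o \<kappa>"
      using \<kappa> by (intro card_of_UNION_ordLeq_infinite_Field[OF \<kappa>inf _ S(2)]) auto
    then have "|\<Union>x \<in> S. \<B> x| \<le>o ?N" by (rule ordLeq_transitive[OF _ \<kappa>N])
    then have "|Vs S| \<le>o ?N" unfolding Vs_def by (rule card_of_small_subsets_le[OF \<kappa>])
    then have 2: "|\<Union>\<V> \<in> Vs S. C \<V>| \<le>o ?N"
      using N C_card by (intro card_of_UNION_ordLeq_infinite_Field[OF Ninf]) auto
    show ?thesis
      unfolding F_def using N by (intro card_of_Un_ordLeq_infinite_Field[OF Ninf 1 2]) auto
  qed
  obtain H where H: "H \<subseteq> topspace X" "|H| \<le>o ?N" "\<And>S. S \<subseteq> H \<Longrightarrow> |S| \<le>o \<kappa> \<Longrightarrow> F S \<subseteq> H"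
    by (rule closing_off[of \<kappa> "topspace X" F, OF \<kappa> FT F_card],
        assumption, assumption, rule that) simp_all
  have "X closure_of H \<subseteq> H"
  proof
    fix x assume "x \<in> X closure_of H"
    then obtain S where "S \<subseteq> H" "|S| \<le>o \<kappa>" "x \<in> X closure_of S"
      using t H(1) unfolding tightness_le_def by meson
    then show "x \<in> H" using H(3) unfolding F_def by blast
  qed
  then have "closedin X H"
    using H(1) by (metis closedin_closure_of closure_of_subset subset_antisym)
  have "topspace X \<subseteq> H"
  proof
    fix p assume p: "p \<in> topspace X"
    show "p \<in> H"
    proof (rule ccontr)
      assume pH: "p \<notin> H"
      have "\<exists>B \<in> \<B> x. p \<notin> X closure_of B" if "x \<in> H" for x
      proof -
        have "p \<notin> (\<Inter>B \<in> \<B> x. X closure_of B)"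
          using \<B>[of x] that H(1) pH by (metis singletonD subsetD)
        then show ?thesis by blast
      qed
      then obtain g where g: "\<And>x. x \<in> H \<Longrightarrow> g x \<in> \<B> x \<and> p \<notin> X closure_of g x" by metis
      have "\<forall>U \<in> g ` H. openin X U" "H \<subseteq> \<Union>(g ` H)" using g \<B> H(1) by blast+
      then obtain \<V> where \<V>: "\<V> \<subseteq> g ` H" "|\<V>| \<le>o \<kappa>"
        "|H - (\<Union>V \<in> \<V>. X closure_of V)| <o \<mu>"
        using L[OF \<open>closedin X H\<close>] unfolding saL_le_def by meson
      \<comment> \<open>Choosing one point for each member of \<open>\<V>\<close> shows that \<open>\<V>\<close> is among the families considered
        for some small \<open>S \<subseteq> H\<close>.\<close>
      obtain S where S: "S \<subseteq> H" "inj_on g S" "\<V> = g ` S"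
        using \<V>(1) unfolding subset_image_inj by blast
      have "|S| \<le>o \<kappa>"
        using ordIso_ordLeq_trans[OF card_of_ordIsoI[of g S \<V>] \<V>(2)] S
        unfolding bij_betw_def by blast
      moreover have "\<V> \<in> Vs S" unfolding Vs_def using S g \<V>(2) by blast
      ultimately have CH: "C \<V> \<subseteq> H" using H(3)[OF S(1)] unfolding F_def by blast
      \<comment> \<open>As \<open>p\<close> is uncovered but not in \<open>H\<close>, the set \<open>C \<V>\<close> is not everything uncovered, so it is large.\<close>
      have "p \<in> ?out \<V>" using p g S by blast
      with CH pH C_big[of \<V>] have "?N \<le>o |C \<V>|" by auto
      moreover have "C \<V> \<subseteq> H - (\<Union>V \<in> \<V>. X closure_of V)" using CH C_sub[of \<V>] by blast
      ultimately have "?N \<le>o |H - (\<Union>V \<in> \<V>. X closure_of V)|"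
        by (rule ordLeq_transitive[OF _ card_of_mono1])
      then have "\<mu> \<le>o |H - (\<Union>V \<in> \<V>. X closure_of V)|" by (rule ordLeq_transitive[OF \<mu>])
      with \<V>(3) show False using not_ordLess_ordLeq by blast
    qed
  qed
  then show ?thesis by (rule ordLeq_transitive[OF card_of_mono1 H(2)])
qed

lemma tightness_le_mono: "tightness_le X \<kappa> \<Longrightarrow> \<kappa> \<le>o \<kappa>' \<Longrightarrow> tightness_le X \<kappa>'"
  unfolding tightness_le_def using ordLeq_transitive by meson

lemma closed_pseudo_character_le_mono:
  "closed_pseudo_character_le X \<kappa> \<Longrightarrow> \<kappa> \<le>o \<kappa>' \<Longrightarrow> closed_pseudo_character_le X \<kappa>'"
  unfolding closed_pseudo_character_le_def using ordLeq_transitive by meson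

lemma saL_le_mono: "saL_le A X \<mu> \<kappa> \<Longrightarrow> \<kappa> \<le>o \<kappa>' \<Longrightarrow> saL_le A X \<mu> \<kappa>'"
  unfolding saL_le_def using ordLeq_transitive by meson

lemma ordLeq_cprod1: "Card_order p \<Longrightarrow> Cnotzero q \<Longrightarrow> p \<le>o p *c q"
  by (rule ordLeq_ordIso_trans[OF ordLeq_cprod2 cprod_com])

theorem corollary4p6:
  fixes X :: "'a topology"
  assumes "Hausdorff_space X"
  shows "|topspace X| \<le>o
    ctwo ^c (saL_c X (ctwo ^c (tightness X *c closed_pseudo_character X))
      *c tightness X *c closed_pseudo_character X)"
proof -
  let ?t = "tightness X" and ?\<psi> = "closed_pseudo_character X"
  let ?\<mu> = "ctwo ^c (?t *c ?\<psi>)"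
  let ?L = "saL_c X ?\<mu>"
  let ?\<kappa> = "?L *c ?t *c ?\<psi>"
  note t = tightness[of X] and \<psi> = closed_pseudo_character[OF assms]
  have t\<psi>: "Cinfinite (?t *c ?\<psi>)" using t \<psi> by (simp add: cinfinite_cprod Card_order_cprod)
  then have \<mu>: "Cinfinite ?\<mu>" by (rule Cinfinite_ctwo_cexp)
  then have L: "Cinfinite ?L" using saL_c[of ?\<mu> X] by blast
  have \<kappa>: "Cinfinite ?\<kappa>" using L t\<psi> by (simp add: cinfinite_cprod Card_order_cprod)
  have le: "?t *c ?\<psi> \<le>o ?\<kappa>" using L t\<psi> by (intro ordLeq_cprod2 Cinfinite_Cnotzero) auto
  have "?t \<le>o ?\<kappa>"
    using t \<psi> by (intro ordLeq_transitive[OF ordLeq_cprod1 le] Cinfinite_Cnotzero) auto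
  moreover have "?\<psi> \<le>o ?\<kappa>"
    using t \<psi> by (intro ordLeq_transitive[OF ordLeq_cprod2 le] Cinfinite_Cnotzero) auto
  moreover have "saL_le A X ?\<mu> ?\<kappa>" if "closedin X A" for A
  proof -
    have "saL A X ?\<mu> \<le>o ?L" using saL_c(3) \<mu> that by blast
    moreover have "?L \<le>o ?\<kappa>" using L t\<psi> by (intro ordLeq_cprod1 Cinfinite_Cnotzero) auto
    ultimately have "saL A X ?\<mu> \<le>o ?\<kappa>" by (rule ordLeq_transitive)
    moreover have "saL_le A X ?\<mu> (saL A X ?\<mu>)" using saL(3) \<mu> by blast
    ultimately show ?thesis using saL_le_mono by blast
  qed
  moreover have "?\<mu> \<le>o ctwo ^c ?\<kappa>"
    using le t\<psi> by (intro cexp_mono2_Cnotzero Card_order_ctwo Cinfinite_Cnotzero)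
  ultimately show ?thesis
    using \<kappa> t(3) \<psi>(3)
    by (intro card_of_topspace_le) (auto intro: tightness_le_mono closed_pseudo_character_le_mono)
qed

end
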